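(* Let $m$ be a positive integer, let $f = (\frac{1}{m}, \ldots, \frac{1}{m}) \in \mathbb{R}^{2m}$, let $N$ be the lattice $N = \mathbb{Z}^{2m} + \mathbb{Z} \cdot f$ in $\mathbb{R}^{2m}$, and let $P \subset \mathbb{R}^{2m}$ be the polytope with vertices $e_1, \ldots, e_{2m}, e_1 - f, \ldots, e_{2m} - f$, where $e_1,\ldots,e_{2m}$ is the standard basis. Then $P$ is reflexive (with respect to $N$), and $$\delta_P = (1, 2m, 2m+2, 2m, 2m+2, \ldots, 2m, 2m+2, 2m, 1),$$ that is, $\delta_0 = \delta_{2m} = 1$, $\delta_i = 2m$ for odd $i$ with $1 \le i \le 2m-1$, and $\delta_i = 2m+2$ for even $i$ with $2 \le i \le 2m-2$. In particular, there are $\lfloor \frac{m-1}{2} \rfloor$ descents in $(\delta_0, \delta_1, \ldots, \delta_m)$.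
   Context: For a $d$-dimensional lattice polytope $P$ in $N_{\mathbb{R}}$ (vertices in the lattice $N$ of rank $d$), $f_P(k)$ denotes the number of points of $N$ in $kP$ for integers $k \ge 0$, and $\delta_P = (\delta_0, \ldots, \delta_d)$ is defined by $$\sum_{k \ge 0} f_P(k) t^k = \frac{\delta_0 + \delta_1 t + \cdots + \delta_d t^d}{(1-t)^{d+1}}.$$ A lattice polytope is reflexive if it contains $0$ in its interior and its polar polytope has vertices in the dual lattice $\mathrm{Hom}(N,\mathbb{Z})$. A descent in a sequence $(\delta_0, \ldots, \delta_m)$ is an index $i$ with $0 \le i < m$ and $\delta_i > \delta_{i+1}$. Here $d = 2m$ and $N_{\mathbb{R}} = \mathbb{R}^{2m}$. *)

theory Defs
  imports "HOL-Analysis.Analysis" "HOL-Computational_Algebra.Formal_Power_Series"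
begin

definition full_rank_lattice :: "'a::euclidean_space set \<Rightarrow> bool" where
  "full_rank_lattice N \<longleftrightarrow>
     (\<exists>B. independent B \<and> span B = UNIV \<and>
          N = {\<Sum>b\<in>B. of_int (c b) *\<^sub>R b | c. True})"

definition lattice_polytope :: "'a::euclidean_space set \<Rightarrow> 'a set \<Rightarrow> bool" where
  "lattice_polytope N P \<longleftrightarrow>
     full_rank_lattice N \<and> polytope P \<and> {v. v extreme_point_of P} \<subseteq> N"

text \<open>
  The dual of the ambient space is identified with the space itself through the inner
  product. Under this identification a homomorphism from a full-rank lattice \<open>N\<close> to the
  integers, extended linearly, is a vector pairing integrally with \<open>N\<close>.
\<close>

definition dual_lattice :: "'a::euclidean_space set \<Rightarrow> 'a set" where
  "dual_lattice N = {u. \<forall>x\<in>N. u \<bullet> x \<in> \<int>}"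

text \<open>
  The other usual sign convention, \<open>u \<bullet> x \<le> 1\<close>, replaces the polar by its negative
  and hence gives the same notion of reflexivity.
\<close>

definition polar :: "'a::euclidean_space set \<Rightarrow> 'a set" where
  "polar P = {u. \<forall>x\<in>P. u \<bullet> x \<ge> -1}"

definition reflexive :: "'a::euclidean_space set \<Rightarrow> 'a set \<Rightarrow> bool" where
  "reflexive N P \<longleftrightarrow>
     lattice_polytope N P \<and> 0 \<in> interior P \<and>
     polytope (polar P) \<and> {u. u extreme_point_of polar P} \<subseteq> dual_lattice N"

definition lattice_count :: "'a::euclidean_space set \<Rightarrow> 'a set \<Rightarrow> nat \<Rightarrow> nat" where
  "lattice_count N P k = card (N \<inter> (\<lambda>x. real k *\<^sub>R x) ` P)"

definition ehrhart_series :: "'a::euclidean_space set \<Rightarrow> 'a set \<Rightarrow> real fps" where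
  "ehrhart_series N P = Abs_fps (\<lambda>k. real (lattice_count N P k))"

text \<open>
  Intended for polytopes of full dimension \<open>d = DIM('a)\<close>. A list satisfying the
  condition is unique; that one exists is Ehrhart's theorem.
\<close>

definition delta_vector :: "'a::euclidean_space set \<Rightarrow> 'a set \<Rightarrow> real list" where
  "delta_vector N P =
     (THE \<delta>. length \<delta> = DIM('a) + 1 \<and>
        ehrhart_series N P =
          (\<Sum>i\<le>DIM('a). fps_const (\<delta> ! i) * fps_X ^ i) / (1 - fps_X) ^ (DIM('a) + 1))"

definition descents :: "'a::linorder list \<Rightarrow> nat set" where
  "descents xs = {i. i + 1 < length xs \<and> xs ! i > xs ! (i + 1)}"

end

(* Write s(x) for the sum of the coordinates of x. Since s(f) = 2, P is the prism over the
   standard simplex in direction -f, and it is cut out by |s(x)| <= 1 and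
   s(x) - 2m x_i <= 1 for all i. All facets are at height 1, and their normals are integral
   on N, so P is reflexive.

   As m f is the all-ones vector, a point of N is uniquely z + j f with z integral, min z = 0
   and j an integer. It lies in k P iff a = sum z satisfies a <= k and |a + 2j| <= k. For given
   a <= k the number of j is k, plus 1 if a and k have the same parity, and the number A(a) of
   such z has generating function A(t) = (1 - t^d) / (1 - t)^d with d = 2m. Hence the Ehrhart
   series is t (A(t) / (1 - t))' + A(t) / (1 - t^2). Multiplied by (1 - t)^(d + 1), this is
   (d + 1) (t + ... + t^d) - d t^d + (1 - t + t^2 - ... - t^(d - 1)). *)
theory Submission
  imports Defs
begin

section \<open>Counting and generating functions\<close>

unbundle no vec_syntax and fps_syntax

section \<open>Tuples of naturals with prescribed sum\<close>

lemma finite_nat_functions_sum: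
  "finite {z :: 'n::finite \<Rightarrow> nat. sum z UNIV = a}"
proof (rule finite_subset)
  show "{z :: 'n \<Rightarrow> nat. sum z UNIV = a} \<subseteq> UNIV \<rightarrow>\<^sub>E {..a}"
    by (auto simp: PiE_def intro: member_le_sum)
qed (simp add: finite_PiE)

text \<open>Coefficients of powers of a series are sums over the lists in \<open>natpermute\<close>;
  an enumeration \<open>h\<close> of the index type carries functions over to these lists.\<close>

lemma card_nat_functions_sum_eq_natpermute:
  "card {z :: 'n::finite \<Rightarrow> nat. sum z UNIV = a} = card (natpermute a CARD('n))"
proof -
  obtain h :: "nat \<Rightarrow> 'n" where h: "bij_betw h {0..<CARD('n)} UNIV"
    using ex_bij_betw_nat_finite[of "UNIV :: 'n set"] by auto
  define g where "g = the_inv_into {0..<CARD('n)} h"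
  have g: "bij_betw g UNIV {0..<CARD('n)}"
    unfolding g_def by (rule bij_betw_the_inv_into[OF h])
  have gh: "g (h i) = i" if "i < CARD('n)" for i
    using h that unfolding g_def by (intro the_inv_into_f_f) (auto simp: bij_betw_def)
  have hg: "h (g x) = x" for x
    using h unfolding g_def by (intro f_the_inv_into_f) (auto simp: bij_betw_def)
  have g_less: "g x < CARD('n)" for x
    using bij_betwE[OF g] by auto
  have "bij_betw (\<lambda>z. map (\<lambda>i. z (h i)) [0..<CARD('n)]) {z. sum z UNIV = a} (natpermute a CARD('n))"
  proof (rule bij_betw_byWitness[where f' = "\<lambda>l x. l ! g x"])
    show "\<forall>z\<in>{z. sum z UNIV = a}. (\<lambda>x. map (\<lambda>i. z (h i)) [0..<CARD('n)] ! g x) = z"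
      using g_less by (auto simp: hg)
    show "\<forall>l\<in>natpermute a CARD('n). map (\<lambda>i. l ! g (h i)) [0..<CARD('n)] = l"
      by (auto simp: natpermute_def gh intro!: nth_equalityI)
    have "sum_list (map (\<lambda>i. z (h i)) [0..<CARD('n)]) = sum z UNIV" for z :: "'n \<Rightarrow> nat"
      using sum.reindex_bij_betw[OF h, of z] by (simp add: interv_sum_list_conv_sum_set_nat)
    then show "(\<lambda>z. map (\<lambda>i. z (h i)) [0..<CARD('n)]) ` {z. sum z UNIV = a} \<subseteq> natpermute a CARD('n)"
      by (auto simp: natpermute_def)
    have "(\<Sum>x\<in>UNIV. l ! g x) = sum_list l" if "length l = CARD('n)" for l :: "nat list"
      using sum.reindex_bij_betw[OF g, of "\<lambda>i. l ! i"] that by (simp add: sum_list_sum_nth)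
    then show "(\<lambda>l x. l ! g x) ` natpermute a CARD('n) \<subseteq> {z. sum z UNIV = a}"
      by (auto simp: natpermute_def)
  qed
  then show ?thesis by (rule bij_betw_same_card)
qed

text \<open>In a power of the geometric series every product of coefficients is 1, so each
  coefficient counts the lists in \<open>natpermute\<close>.\<close>

lemma fps_card_nat_functions_sum:
  "Abs_fps (\<lambda>a. real (card {z :: 'n::finite \<Rightarrow> nat. sum z UNIV = a})) * (1 - fps_X) ^ CARD('n) = 1"
proof -
  let ?G = "Abs_fps (\<lambda>_. 1 :: real)"
  have "Abs_fps (\<lambda>a. real (card {z :: 'n \<Rightarrow> nat. sum z UNIV = a})) = ?G ^ CARD('n)"
  proof (rule fps_ext)
    fix a
    have "(\<Prod>j=0..CARD('n) - 1. ?G $ (v ! j)) = 1" for v :: "nat list"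
      by simp
    then show "Abs_fps (\<lambda>a. real (card {z :: 'n \<Rightarrow> nat. sum z UNIV = a})) $ a = (?G ^ CARD('n)) $ a"
      by (simp add: fps_power_nth card_nat_functions_sum_eq_natpermute)
  qed
  moreover have "?G * (1 - fps_X) = 1"
    by (rule fps_ext) (simp add: algebra_simps)
  ultimately show ?thesis
    by (simp flip: power_mult_distrib)
qed

text \<open>Subtract 1 from every value. The case \<open>a < CARD('n)\<close> is separate because
  the truncated difference would be 0 and count the zero function.\<close>

lemma card_nat_functions_sum_pos:
  "card {z :: 'n::finite \<Rightarrow> nat. sum z UNIV = a \<and> (\<forall>i. z i > 0)} =
    (if a < CARD('n) then 0 else card {z :: 'n \<Rightarrow> nat. sum z UNIV = a - CARD('n)})"
proof (cases "a < CARD('n)")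
  case True
  have "sum z UNIV \<noteq> a" if "\<forall>i. z i > 0" for z :: "'n \<Rightarrow> nat"
    using sum_mono[of UNIV "\<lambda>_. 1" z] that True by (simp add: Suc_le_eq)
  then have "{z :: 'n \<Rightarrow> nat. sum z UNIV = a \<and> (\<forall>i. z i > 0)} = {}"
    by blast
  with True show ?thesis by (simp only: card.empty if_True)
next
  case False
  have sum_Suc: "(\<Sum>i\<in>UNIV. Suc (z i)) = sum z UNIV + CARD('n)" for z :: "'n \<Rightarrow> nat"
    using sum.distrib[of z "\<lambda>_. 1" UNIV] by simp
  have "bij_betw (\<lambda>z i. Suc (z i)) {z :: 'n \<Rightarrow> nat. sum z UNIV = a - CARD('n)}
    {z. sum z UNIV = a \<and> (\<forall>i. z i > 0)}"
  proof (rule bij_betw_byWitness[where f' = "\<lambda>z i. z i - 1"])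
    show "(\<lambda>z i. z i - 1) ` {z :: 'n \<Rightarrow> nat. sum z UNIV = a \<and> (\<forall>i. z i > 0)}
      \<subseteq> {z. sum z UNIV = a - CARD('n)}"
    proof clarify
      fix z :: "'n \<Rightarrow> nat"
      assume "\<forall>i. z i > 0"
      then show "(\<Sum>i\<in>UNIV. z i - 1) = sum z UNIV - CARD('n)"
        using sum_Suc[of "\<lambda>i. z i - 1"] by simp
    qed
  qed (use False in \<open>auto simp: sum_Suc\<close>)
  with False show ?thesis by (simp add: bij_betw_same_card)
qed

text \<open>These are the numbers A(a) of the overview. The complement consists of the everywhere
  positive functions, whose series is \<open>?C\<close> shifted by \<open>CARD('n)\<close>.\<close>

lemma fps_card_nat_functions_sum_zero:
  "Abs_fps (\<lambda>a. real (card {z :: 'n::finite \<Rightarrow> nat. sum z UNIV = a \<and> (\<exists>i. z i = 0)}))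
    * (1 - fps_X) ^ CARD('n) = 1 - fps_X ^ CARD('n)"
proof -
  let ?C = "Abs_fps (\<lambda>a. real (card {z :: 'n \<Rightarrow> nat. sum z UNIV = a}))"
  have "real (card {z :: 'n \<Rightarrow> nat. sum z UNIV = a \<and> (\<exists>i. z i = 0)}) =
    real (card {z :: 'n \<Rightarrow> nat. sum z UNIV = a}) -
    real (card {z :: 'n \<Rightarrow> nat. sum z UNIV = a \<and> (\<forall>i. z i > 0)})" for a
  proof -
    have "{z :: 'n \<Rightarrow> nat. sum z UNIV = a} =
      {z. sum z UNIV = a \<and> (\<exists>i. z i = 0)} \<union> {z. sum z UNIV = a \<and> (\<forall>i. z i > 0)}"
      by auto
    moreover have "{z :: 'n \<Rightarrow> nat. sum z UNIV = a \<and> (\<exists>i. z i = 0)} \<inter>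
      {z. sum z UNIV = a \<and> (\<forall>i. z i > 0)} = {}"
      by (auto simp: disjoint_iff)
    moreover have "finite {z :: 'n \<Rightarrow> nat. sum z UNIV = a \<and> (\<exists>i. z i = 0)}"
      "finite {z :: 'n \<Rightarrow> nat. sum z UNIV = a \<and> (\<forall>i. z i > 0)}"
      by (rule finite_subset[OF _ finite_nat_functions_sum[of a]]; auto)+
    ultimately have "card {z :: 'n \<Rightarrow> nat. sum z UNIV = a} =
      card {z :: 'n \<Rightarrow> nat. sum z UNIV = a \<and> (\<exists>i. z i = 0)} +
      card {z :: 'n \<Rightarrow> nat. sum z UNIV = a \<and> (\<forall>i. z i > 0)}"
      by (simp only: card_Un_disjoint)
    then show ?thesis by simp
  qed
  then have split: "Abs_fps (\<lambda>a. real (card {z :: 'n \<Rightarrow> nat. sum z UNIV = a \<and> (\<exists>i. z i = 0)})) =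
    ?C - fps_X ^ CARD('n) * ?C"
    by (intro fps_ext) (simp add: card_nat_functions_sum_pos fps_X_power_mult_nth)
  have "Abs_fps (\<lambda>a. real (card {z :: 'n \<Rightarrow> nat. sum z UNIV = a \<and> (\<exists>i. z i = 0)}))
    * (1 - fps_X) ^ CARD('n) = (1 - fps_X ^ CARD('n)) * (?C * (1 - fps_X) ^ CARD('n))"
    unfolding split by (simp add: algebra_simps)
  then show ?thesis by (simp add: fps_card_nat_functions_sum)
qed

section \<open>Parity weights and the Ehrhart series in closed form\<close>

lemma abs_add_double_le_iff:
  "{j :: int. \<bar>a + 2 * j\<bar> \<le> k} = {- ((k + a) div 2)..(k - a) div 2}"
  by auto

text \<open>Since \<open>k - a\<close> and \<open>k + a\<close> have the same parity, the two floors
  in the interval bounds add up to \<open>k\<close> or to \<open>k - 1\<close>.\<close>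

lemma card_abs_add_double_le:
  "card {j :: int. \<bar>int a + 2 * j\<bar> \<le> int k} = k + (if even (a + k) then 1 else 0)"
proof -
  have "(int k - int a) div 2 + (int k + int a) div 2 + 1 = int (k + (if even (a + k) then 1 else 0))"
    by (auto, presburger+)
  moreover have "card {j :: int. \<bar>int a + 2 * j\<bar> \<le> int k} = nat ((int k - int a) div 2 + (int k + int a) div 2 + 1)"
    unfolding abs_add_double_le_iff by simp
  ultimately show ?thesis by (simp only: nat_int)
qed

text \<open>The weight \<open>k\<close> on partial sums of \<open>A\<close> is the operator X d/dX
  applied to \<open>B\<close>, and the parity weight is convolution with 1 / (1 - X^2). The two
  contributions are cleared of denominators separately, in \<open>part1\<close> and
  \<open>part2\<close>.\<close>

lemma fps_parity_convolution:
  fixes A :: "nat \<Rightarrow> real"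
  assumes A: "Abs_fps A * (1 - fps_X) ^ d = 1 - fps_X ^ d" and d: "even d" "d > 0"
  shows "Abs_fps (\<lambda>k. \<Sum>a\<le>k. A a * real (k + (if even (a + k) then 1 else 0))) * (1 - fps_X) ^ (d + 1) =
    Abs_fps (\<lambda>i. if i = 0 \<or> i = d then 1 else if i > d then 0 else if odd i then real d else real d + 2)"
    (is "?E * _ = ?Q")
proof -
  let ?X = "fps_X :: real fps"
  let ?G = "Abs_fps (\<lambda>_. 1 :: real)"
  let ?H = "Abs_fps (\<lambda>k. if even k then 1 else 0 :: real)"
  define B where "B = Abs_fps A * ?G"
  have G: "?G * (1 - ?X) = 1"
    by (rule fps_ext) (simp add: algebra_simps)
  have H: "?H * (1 + ?X) * (1 - ?X) = 1"
  proof -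
    have "?H * (1 + ?X) = ?G"
      by (rule fps_ext) (auto simp: algebra_simps)
    then show ?thesis using G by simp
  qed
  have E: "?E = ?X * fps_deriv B + Abs_fps A * ?H"
  proof (rule fps_ext)
    fix k
    have "B $ k = (\<Sum>a\<le>k. A a)"
      by (simp add: B_def fps_mult_nth atLeast0AtMost)
    moreover have "(?X * fps_deriv B) $ k = real k * B $ k"
      by (cases k) auto
    moreover have "(Abs_fps A * ?H) $ k = (\<Sum>a\<le>k. A a * (if even (a + k) then 1 else 0))"
      by (auto simp: fps_mult_nth atLeast0AtMost intro!: sum.cong)
    ultimately show "?E $ k = (?X * fps_deriv B + Abs_fps A * ?H) $ k"
      by (auto simp: sum_distrib_left sum.distrib[symmetric] algebra_simps intro!: sum.cong)
  qed
  have B: "B * (1 - ?X) ^ (d + 1) = 1 - ?X ^ d"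
  proof -
    have "B * (1 - ?X) ^ (d + 1) = (Abs_fps A * (1 - ?X) ^ d) * (?G * (1 - ?X))"
      by (simp add: B_def algebra_simps)
    then show ?thesis by (simp add: A G)
  qed
  \<comment> \<open>One factor \<open>1 - ?X\<close> is cancelled because the product rule below
    produces \<open>B\<close> with exponent \<open>d\<close> only.\<close>
  have "1 - ?X ^ d = (\<Sum>i<d. ?X ^ i) * (1 - ?X)"
    by (simp add: one_diff_power_eq mult.commute)
  with B have "(B * (1 - ?X) ^ d) * (1 - ?X) = (\<Sum>i<d. ?X ^ i) * (1 - ?X)"
    by (simp add: algebra_simps)
  moreover have X0: "1 - ?X \<noteq> 0" "1 + ?X \<noteq> 0"
    using G H by auto
  ultimately have B': "B * (1 - ?X) ^ d = (\<Sum>i<d. ?X ^ i)"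
    by simp
  \<comment> \<open>Differentiating the same product by its closed form and by the product rule
    gives the derivative of \<open>B\<close> without a quotient rule.\<close>
  have deriv1: "fps_deriv (B * (1 - ?X) ^ (d + 1)) = - (of_nat d * ?X ^ (d - 1))"
    unfolding B by (simp add: fps_deriv_power fps_of_nat)
  have deriv2: "fps_deriv (B * (1 - ?X) ^ (d + 1)) =
    fps_deriv B * (1 - ?X) ^ (d + 1) - of_nat (d + 1) * (B * (1 - ?X) ^ d)"
    by (simp add: fps_deriv_power fps_of_nat mult_ac del: of_nat_add of_nat_Suc power_Suc)
  have *: "fps_deriv B * (1 - ?X) ^ (d + 1) = of_nat (d + 1) * (B * (1 - ?X) ^ d) - of_nat d * ?X ^ (d - 1)"
    using deriv2[unfolded deriv1 eq_diff_eq] by (metis add.commute diff_conv_add_uminus)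
  have part1: "?X * fps_deriv B * (1 - ?X) ^ (d + 1) =
    of_nat (d + 1) * (\<Sum>i<d. ?X ^ Suc i) - of_nat d * ?X ^ d"
  proof -
    have "?X * fps_deriv B * (1 - ?X) ^ (d + 1) =
      of_nat (d + 1) * (?X * (\<Sum>i<d. ?X ^ i)) - of_nat d * (?X * ?X ^ (d - 1))"
      unfolding mult.assoc * B' by (simp only: algebra_simps)
    also have "?X * ?X ^ (d - 1) = ?X ^ d"
      using d by (simp flip: power_Suc)
    finally show ?thesis by (simp add: sum_distrib_left)
  qed
  \<comment> \<open>For even \<open>d\<close> the power of \<open>- ?X\<close> equals that of
    \<open>?X\<close>, so \<open>1 + ?X\<close> divides the numerator and cancels the same factor in
    the denominator of \<open>?H\<close>.\<close>
  have "1 - ?X ^ d = (\<Sum>i<d. (- ?X) ^ i) * (1 + ?X)"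
    using one_diff_power_eq[of "- ?X" d] d by (simp add: mult.commute)
  then have "(Abs_fps A * (1 - ?X) ^ d) * (?H * (1 - ?X)) = (\<Sum>i<d. (- ?X) ^ i) * (?H * (1 + ?X) * (1 - ?X))"
    unfolding A by (simp only: mult_ac)
  moreover have "Abs_fps A * ?H * (1 - ?X) ^ (d + 1) = (Abs_fps A * (1 - ?X) ^ d) * (?H * (1 - ?X))"
    by (simp add: mult_ac)
  ultimately have part2: "Abs_fps A * ?H * (1 - ?X) ^ (d + 1) = (\<Sum>i<d. (- ?X) ^ i)"
    by (simp only: H mult_1_right)
  have "?E * (1 - ?X) ^ (d + 1) = of_nat (d + 1) * (\<Sum>i<d. ?X ^ Suc i) - of_nat d * ?X ^ d + (\<Sum>i<d. (- ?X) ^ i)"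
    unfolding E distrib_right part1 part2 ..
  \<comment> \<open>Strictly between 0 and \<open>d\<close> the coefficient is \<open>d + 1\<close>
    plus or minus 1. At \<open>d\<close> the alternating sum has ended and \<open>d + 1 - d\<close>
    remains; at 0 only the alternating sum contributes.\<close>
  also have "\<dots> = ?Q"
  proof (rule fps_ext)
    fix i
    have "(\<Sum>j<d. ?X ^ Suc j) $ i = (if 1 \<le> i \<and> i \<le> d then 1 else 0)"
    proof (cases i)
      case (Suc j)
      have "(\<Sum>j<d. ?X ^ Suc j) $ i = (\<Sum>j'<d. if j' = j then 1 else 0)"
        unfolding fps_sum_nth by (rule sum.cong) (auto simp: Suc fps_X_power_nth simp del: power_Suc)
      then show ?thesis by (auto simp: Suc)
    qed (simp add: fps_sum_nth)
    moreover have "(\<Sum>j<d. (- ?X) ^ j) $ i = (if i < d then (-1) ^ i else 0)"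
    proof -
      have eq: "(- ?X) ^ j = fps_const ((-1) ^ j) * ?X ^ j" for j
        by (simp add: power_minus[of ?X] fps_const_power[symmetric] fps_const_neg[symmetric] del: fps_const_neg)
      have "(\<Sum>j<d. (- ?X) ^ j) $ i = (\<Sum>j<d. if j = i then (-1) ^ i else 0)"
        unfolding fps_sum_nth eq by (intro sum.cong) (auto simp: fps_X_power_nth)
      then show ?thesis by auto
    qed
    ultimately show "(of_nat (d + 1) * (\<Sum>i<d. ?X ^ Suc i) - of_nat d * ?X ^ d + (\<Sum>i<d. (- ?X) ^ i)) $ i = ?Q $ i"
      using d by (auto simp: fps_of_nat[symmetric] fps_X_power_nth simp del: of_nat_add of_nat_Suc fps_of_nat power_Suc)
  qed
  finally show ?thesis .
qed

text \<open>The denominator is a unit, as its constant term is 1, so the defining equation can be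
  multiplied out. Comparing coefficients then gives both existence and uniqueness for the definite
  description.\<close>

lemma delta_vector_eqI:
  fixes N P :: "'a::euclidean_space set"
  assumes series: "ehrhart_series N P * (1 - fps_X) ^ (DIM('a) + 1) = Abs_fps q"
    and q: "\<And>i. i > DIM('a) \<Longrightarrow> q i = 0"
  shows "delta_vector N P = map q [0..<DIM('a) + 1]"
proof -
  let ?D = "(1 - fps_X :: real fps) ^ (DIM('a) + 1)"
  have D: "?D $ 0 \<noteq> 0" by simp
  then have D0: "?D \<noteq> 0" by (metis fps_zero_nth)
  have poly_nth: "(\<Sum>i\<le>DIM('a). fps_const (l ! i) * fps_X ^ i) $ j = (if j \<le> DIM('a) then l ! j else 0)"
    for l :: "real list" and j
  proof -
    have "(\<Sum>i\<le>DIM('a). fps_const (l ! i) * fps_X ^ i) $ j = (\<Sum>i\<le>DIM('a). if i = j then l ! j else 0)"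
      unfolding fps_sum_nth by (intro sum.cong) (auto simp: fps_X_power_nth)
    then show ?thesis by auto
  qed
  have quotient_eq_iff: "F = Q / ?D \<longleftrightarrow> Q = F * ?D" for F Q
  proof -
    have "Q / ?D * ?D = Q"
      by (simp add: fps_divide_unit[OF D] mult.assoc inverse_mult_eq_1[OF D] del: power_Suc)
    moreover have "F = Q / ?D \<longleftrightarrow> F * ?D = Q / ?D * ?D"
      by (simp only: mult_right_cancel[OF D0])
    ultimately show ?thesis by auto
  qed
  have "(\<Sum>i\<le>DIM('a). fps_const (map q [0..<DIM('a) + 1] ! i) * fps_X ^ i) = Abs_fps q"
    by (rule fps_ext, unfold poly_nth) (simp add: q del: upt_Suc)
  moreover have "l = map q [0..<DIM('a) + 1]"
    if "length l = DIM('a) + 1" "(\<Sum>i\<le>DIM('a). fps_const (l ! i) * fps_X ^ i) = Abs_fps q" for l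
  proof (rule nth_equalityI)
    fix i assume "i < length l"
    then show "l ! i = map q [0..<DIM('a) + 1] ! i"
      using that poly_nth[of l i] by (simp del: upt_Suc)
  qed (use that in simp)
  ultimately show ?thesis
    unfolding delta_vector_def quotient_eq_iff series
    by (intro the_equality) (auto simp del: upt_Suc)
qed

unbundle no fps_syntax and vec_syntax

section \<open>The polytope\<close>

text \<open>Applied twice, this adds two extra points to a convex combination indexed by
  \<open>'n\<close>.\<close>

lemma sum_UNIV_option: "(\<Sum>x\<in>UNIV. g x) = g None + (\<Sum>i\<in>UNIV. g (Some i))"
  for g :: "'b::finite option \<Rightarrow> 'c::comm_monoid_add"
  by (simp add: UNIV_option_conv sum.reindex)

locale simplex_prism =
  fixes m :: nat
    and f :: "real ^ 'n"
    and N V P :: "(real ^ 'n) set"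
  assumes m_pos: "m > 0"
    and card_index: "CARD('n) = 2 * m"
    and f_eq: "f = (\<chi> i. 1 / real m)"
    and N_eq: "N = {z + of_int k *\<^sub>R f | z k. \<forall>i. z $ i \<in> \<int>}"
    and V_eq: "V = {axis i 1 | i. True} \<union> {axis i 1 - f | i. True}"
    and P_eq_hull: "P = convex hull V"
begin

lemma inner_one: "(1 :: real ^ 'n) \<bullet> x = (\<Sum>i\<in>UNIV. x $ i)"
  by (simp add: inner_vec_def)

lemma axis_one_nth: "axis i (1 :: real) $ j = (if j = i then 1 else 0)"
  by (simp add: axis_def)

lemma f_nth [simp]: "f $ i = 1 / real m"
  by (simp add: f_eq)

lemma inner_one_f [simp]: "1 \<bullet> f = 2"
  using m_pos by (simp add: inner_one card_index)

lemma f_inner_one [simp]: "f \<bullet> 1 = 2"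
  by (simp add: inner_commute[of f])

lemma inner_one_axis [simp]: "(1 :: real ^ 'n) \<bullet> axis i 1 = 1"
  by (simp add: inner_axis)

section \<open>Facets, vertices and interior of \<open>P\<close>, and a basis of
  \<open>N\<close>\<close>

lemma finite_V: "finite V"
proof -
  have "V = range (\<lambda>i. axis i 1) \<union> range (\<lambda>i. axis i 1 - f)"
    by (auto simp: V_eq)
  then show ?thesis by simp
qed

text \<open>The absolute value gives the two simplices at the ends of the prism; the inequality for
  \<open>i\<close> gives the side wall over a facet of the simplex.\<close>

lemma P_eq: "P = {x. \<bar>1 \<bullet> x\<bar> \<le> 1 \<and> (\<forall>i. 1 \<bullet> x - 2 * real m * x $ i \<le> 1)}" (is "_ = ?R")
proof
  have "?R = {x. 1 \<bullet> x \<le> 1} \<inter> {x. 1 \<bullet> x \<ge> -1} \<inter>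
    (\<Inter>i. {x. (1 - (2 * real m) *\<^sub>R axis i 1) \<bullet> x \<le> 1})"
    by (auto simp: inner_diff_left inner_axis')
  then have "convex ?R"
    by (simp only:) (intro convex_Int convex_INT convex_halfspace_le convex_halfspace_ge)
  moreover have "V \<subseteq> ?R"
    using m_pos by (auto simp: V_eq inner_diff_right axis_one_nth right_diff_distrib)
  ultimately show "P \<subseteq> ?R"
    unfolding P_eq_hull by (rule hull_minimal[rotated])
next
  show "?R \<subseteq> P"
  proof
    fix x assume x: "x \<in> ?R"
    \<comment> \<open>\<open>P\<close> is the prism over the standard simplex in direction \<open>- f\<close>: project back along \<open>f\<close>.\<close>
    define t where "t = (1 - 1 \<bullet> x) / 2"
    define y where "y = x + t *\<^sub>R f"
    have t: "0 \<le> t" "t \<le> 1"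
      using x by (auto simp: t_def)
    \<comment> \<open>As \<open>1 \<bullet> f = 2\<close>, the choice of \<open>t\<close> puts
      \<open>y\<close> on the hyperplane of coordinate sum 1, and the wall inequality for
      \<open>i\<close> becomes exactly this one.\<close>
    have y_nonneg: "y $ i \<ge> 0" for i
    proof -
      have "1 \<bullet> x - 2 * real m * x $ i \<le> 1" using x by auto
      then show ?thesis using m_pos by (simp add: y_def t_def field_simps)
    qed
    have y_sum: "(\<Sum>i\<in>UNIV. y $ i) = 1"
      unfolding inner_one[symmetric] by (simp add: y_def t_def inner_add_right field_simps)
    have conv: "convex P" by (simp add: P_eq_hull)
    have y_eq: "y = (\<Sum>i\<in>UNIV. y $ i *\<^sub>R axis i 1)"
      by (simp add: vec_eq_iff axis_one_nth if_distrib cong: if_cong)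
    have "axis i 1 \<in> P" "axis i 1 - f \<in> P" for i
      unfolding P_eq_hull V_eq by (intro hull_inc; blast)+
    then have "(\<Sum>i\<in>UNIV. y $ i *\<^sub>R axis i 1) \<in> P" "(\<Sum>i\<in>UNIV. y $ i *\<^sub>R (axis i 1 - f)) \<in> P"
      using conv y_sum y_nonneg by (intro convex_sum; auto)+
    moreover have "(\<Sum>i\<in>UNIV. y $ i *\<^sub>R (axis i 1 - f)) = y - f"
      using y_sum y_eq by (simp add: scaleR_diff_right sum_subtractf flip: scaleR_left.sum)
    ultimately have "y \<in> P" "y - f \<in> P" by (simp_all flip: y_eq)
    then have "(1 - t) *\<^sub>R y + t *\<^sub>R (y - f) \<in> P"
      using conv t by (intro convexD_alt) auto
    then show "x \<in> P" by (simp add: y_def algebra_simps)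
  qed
qed

text \<open>Each point of \<open>V\<close> is the unique maximizer on \<open>V\<close> of some
  functional, hence outside the hull of the others. In the functional, plus or minus
  \<open>1\<close> favours one end of the prism, and \<open>axis i 1\<close> singles out the vertex
  there.\<close>

lemma extreme_points_P: "{v. v extreme_point_of P} = V"
proof
  show "{v. v extreme_point_of P} \<subseteq> V"
    unfolding P_eq_hull using extreme_point_of_convex_hull by blast
  have exposed: "v extreme_point_of P"
    if v: "v \<in> V" and w: "\<And>w. w \<in> V \<Longrightarrow> w \<noteq> v \<Longrightarrow> u \<bullet> w < u \<bullet> v" for u v
  proof -
    have "V - {v} \<subseteq> {x. u \<bullet> x < u \<bullet> v}"
      using w by auto
    then have "convex hull (V - {v}) \<subseteq> {x. u \<bullet> x < u \<bullet> v}"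
      by (rule hull_minimal) (rule convex_halfspace_lt)
    then have "v \<notin> convex hull (V - {v})" by auto
    then have "v extreme_point_of convex hull (insert v (V - {v}))"
      using finite_V by (intro extreme_point_of_convex_hull_insert) auto
    then show ?thesis using v by (simp add: P_eq_hull insert_absorb)
  qed
  show "V \<subseteq> {v. v extreme_point_of P}"
  proof
    fix v assume v: "v \<in> V"
    then consider i where "v = axis i 1" | i where "v = axis i 1 - f"
      by (auto simp: V_eq)
    then have "v extreme_point_of P"
    proof cases
      case (1 i)
      have neg: "- (1 / real m) < c" if "c > 0" for c
        using that by (rule order.strict_trans1[rotated]) simp
      show ?thesis
        by (rule exposed[OF v, of "axis i 1 + 1"])
          (use 1 m_pos in \<open>auto simp: neg V_eq inner_add_left inner_diff_right inner_axis' axis_one_nth split: if_splits\<close>)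
    next
      case (2 i)
      have small: "1 / real m < c" if "c > 1" for c
        using m_pos by (intro order.strict_trans1[OF _ that]) simp
      show ?thesis
        by (rule exposed[OF v, of "axis i 1 - 1"])
          (use 2 m_pos in \<open>auto simp: small V_eq inner_diff_left inner_diff_right inner_axis' axis_one_nth split: if_splits\<close>)
    qed
    then show "v \<in> {v. v extreme_point_of P}" by simp
  qed
qed

lemma zero_in_interior_P: "0 \<in> interior P"
proof -
  let ?U = "{x. 1 \<bullet> x < 1} \<inter> {x. 1 \<bullet> x > -1} \<inter>
    (\<Inter>i. {x. (1 - (2 * real m) *\<^sub>R axis i 1) \<bullet> x < 1}) :: (real ^ 'n) set"
  have "open ?U"
    by (intro open_Int open_INT ballI open_halfspace_lt open_halfspace_gt) auto
  moreover have "?U \<subseteq> P"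
    by (auto simp: P_eq inner_diff_left inner_axis' abs_le_iff less_imp_le)
  ultimately show ?thesis
    by (rule_tac interiorI[of ?U]) auto
qed

text \<open>A basis is \<open>f\<close> with all standard vectors but one: \<open>m\<close> times
  \<open>f\<close> is the all-ones vector, so the omitted vector is recovered by subtracting the
  others.\<close>

lemma full_rank_lattice_N: "full_rank_lattice N"
proof -
  obtain i0 :: 'n where True by blast
  define E where "E = (\<lambda>i. axis i 1 :: real ^ 'n) ` (UNIV - {i0})"
  define B where "B = insert f E"
  have fin: "finite E" by (simp add: E_def)
  have inj: "inj (\<lambda>i. axis i 1 :: real ^ 'n)"
    by (auto simp: inj_on_def axis_eq_axis)
  have f_ne: "f \<noteq> axis i 1" for i
  proof -
    have "1 \<bullet> f \<noteq> 1 \<bullet> (axis i 1 :: real ^ 'n)" by simp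
    then show ?thesis by metis
  qed
  then have f_notin: "f \<notin> E" by (auto simp: E_def)
  have sum_B: "(\<Sum>b\<in>B. c b *\<^sub>R b) = c f *\<^sub>R f + (\<Sum>i\<in>UNIV - {i0}. c (axis i 1) *\<^sub>R axis i 1)"
    for c :: "real ^ 'n \<Rightarrow> real"
    unfolding B_def using fin f_notin
    by (simp add: E_def sum.reindex inj_on_subset[OF inj])
  have span: "span B = UNIV"
  proof -
    have other: "axis i 1 \<in> span B" if "i \<noteq> i0" for i
      using that by (intro span_base) (auto simp: B_def E_def)
    have "axis i0 1 = real m *\<^sub>R f - (\<Sum>i\<in>UNIV - {i0}. axis i 1)"
      using m_pos by (auto simp: vec_eq_iff axis_one_nth)
    moreover have "f \<in> span B" by (intro span_base) (simp add: B_def)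
    ultimately have "axis i0 1 \<in> span B"
      using other by (auto intro!: span_diff span_scale span_sum)
    with other have "axis i 1 \<in> span B" for i by (cases "i = i0") auto
    then have "(\<Sum>i\<in>UNIV. x $ i *\<^sub>R axis i 1) \<in> span B" for x :: "real ^ 'n"
      by (intro span_sum span_scale)
    moreover have "(\<Sum>i\<in>UNIV. x $ i *\<^sub>R axis i 1) = x" for x :: "real ^ 'n"
      by (simp add: vec_eq_iff axis_one_nth if_distrib cong: if_cong)
    ultimately show ?thesis by auto
  qed
  have "card B = CARD('n)"
    using fin f_notin m_pos
    by (simp add: B_def E_def card_image inj_on_subset[OF inj] card_Diff_singleton card_index)
  then have indep: "independent B"
    using span fin by (intro card_le_dim_spanning[of B UNIV]) (auto simp: B_def)
  have "N = {\<Sum>b\<in>B. of_int (c b) *\<^sub>R b | c. True}"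
  proof (intro equalityI subsetI)
    fix x assume "x \<in> N"
    then obtain z k where x: "x = z + of_int k *\<^sub>R f" and "\<forall>i. z $ i \<in> \<int>"
      by (auto simp: N_eq)
    then have z: "of_int \<lfloor>z $ i\<rfloor> = z $ i" for i by simp
    \<comment> \<open>Obtained by substituting \<open>m\<close> times \<open>f\<close> minus the
      other standard vectors for \<open>axis i0 1\<close> in the expansion of
      \<open>z\<close>.\<close>
    define c where "c b = (if b = f then k + int m * \<lfloor>z $ i0\<rfloor> else \<lfloor>b \<bullet> z\<rfloor> - \<lfloor>z $ i0\<rfloor>)" for b
    have "(\<Sum>b\<in>B. of_int (c b) *\<^sub>R b) =
      (of_int k + real m * z $ i0) *\<^sub>R f + (\<Sum>i\<in>UNIV - {i0}. (z $ i - z $ i0) *\<^sub>R axis i 1)"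
      by (simp add: sum_B c_def z inner_axis' f_ne[symmetric])
    also have "\<dots> = x"
    proof (rule vec_eq_iff[THEN iffD2], rule allI)
      fix j
      have "(\<Sum>i\<in>UNIV - {i0}. (z $ i - z $ i0) *\<^sub>R axis i 1) $ j =
        (\<Sum>i\<in>UNIV - {i0}. if i = j then z $ j - z $ i0 else 0)"
        unfolding sum_component by (intro sum.cong) (auto simp: axis_one_nth)
      also have "\<dots> = z $ j - z $ i0" by auto
      finally show "((of_int k + real m * z $ i0) *\<^sub>R f +
        (\<Sum>i\<in>UNIV - {i0}. (z $ i - z $ i0) *\<^sub>R axis i 1)) $ j = x $ j"
        using m_pos by (simp add: x field_simps)
    qed
    finally show "x \<in> {\<Sum>b\<in>B. of_int (c b) *\<^sub>R b | c. True}" by blast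
  next
    fix x assume "x \<in> {\<Sum>b\<in>B. of_int (c b) *\<^sub>R b | c. True}"
    then obtain c where "x = (\<Sum>b\<in>B. of_int (c b) *\<^sub>R b)" by blast
    then have "x = (\<Sum>i\<in>UNIV - {i0}. of_int (c (axis i 1)) *\<^sub>R axis i 1) + of_int (c f) *\<^sub>R f"
      by (simp add: sum_B)
    moreover have "\<forall>j. (\<Sum>i\<in>UNIV - {i0}. of_int (c (axis i 1)) *\<^sub>R (axis i 1 :: real ^ 'n)) $ j \<in> \<int>"
      by (auto simp: axis_one_nth intro!: Ints_sum)
    ultimately show "x \<in> N" unfolding N_eq by blast
  qed
  with indep span show ?thesis
    unfolding full_rank_lattice_def by blast
qed

section \<open>The polar polytope and reflexivity\<close>

lemma V_subset_N: "V \<subseteq> N"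
proof -
  have "axis i 1 + of_int k *\<^sub>R f \<in> N" for i k
    unfolding N_eq by (rule CollectI) (intro exI conjI, rule refl, simp add: axis_one_nth)
  from this[of _ 0] this[of _ "-1"] show ?thesis
    by (auto simp: V_eq)
qed

text \<open>The generators are the facet normals of \<open>P\<close>, normalized to height -1. The
  polar of the prism is a bipyramid with apexes \<open>1\<close> and \<open>-1\<close>.\<close>

lemma polar_P: "polar P = convex hull ({1, -1} \<union> range (\<lambda>i. (2 * real m) *\<^sub>R axis i 1 - 1))"
  (is "_ = convex hull ?W")
proof
  have "polar P = (\<Inter>x\<in>P. {u. x \<bullet> u \<ge> -1})"
    by (auto simp: polar_def inner_commute)
  then have "convex (polar P)"
    by (simp only:) (intro convex_INT convex_halfspace_ge)
  moreover have "?W \<subseteq> polar P"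
    by (auto simp: polar_def P_eq abs_le_iff inner_diff_left inner_axis') (smt (verit))+
  ultimately show "convex hull ?W \<subseteq> polar P"
    by (rule hull_minimal[rotated])
next
  show "polar P \<subseteq> convex hull ?W"
  proof
    fix u assume u: "u \<in> polar P"
    define w where "w = u + 1"
    define \<sigma> where "\<sigma> = 1 \<bullet> w"
    \<comment> \<open>Weights \<alpha>, \<beta>, \<gamma> on \<open>1\<close>, \<open>-1\<close> and
      the remaining generators must have total 1 and combine to \<open>u\<close>. This forces
      \<beta> and \<gamma> in terms of \<alpha>, and \<alpha> is the least value making \<alpha> and
      \<beta> nonnegative. Then \<gamma> is nonnegative precisely by the inequalities at the two
      vertices \<open>axis i 1\<close> and \<open>axis i 1 - f\<close>.\<close>
    define \<alpha> where "\<alpha> = max 0 (\<sigma> / (2 * real m) - 1)"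
    define \<beta> where "\<beta> = 1 + \<alpha> - \<sigma> / (2 * real m)"
    define \<gamma> where "\<gamma> i = (w $ i - 2 * \<alpha>) / (2 * real m)" for i
    have inner_1_1: "(1 :: real ^ 'n) \<bullet> 1 = 2 * real m"
      by (simp add: inner_one card_index)
    have "f = (1 / real m) *\<^sub>R 1" by (simp add: vec_eq_iff)
    then have u_f: "u \<bullet> f = \<sigma> / real m - 2"
      using m_pos by (simp add: \<sigma>_def w_def inner_add_right inner_1_1 inner_commute[of u 1] field_simps)
    have "axis i 1 \<in> P" "axis i 1 - f \<in> P" for i
      unfolding P_eq_hull V_eq by (intro hull_inc; blast)+
    then have facet: "u \<bullet> axis i 1 \<ge> -1" "u \<bullet> (axis i 1 - f) \<ge> -1" for i
      using u by (auto simp: polar_def)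
    have "w $ i \<ge> 0" "w $ i \<ge> \<sigma> / real m - 2" for i
      using facet[of i] by (simp_all add: w_def inner_axis inner_diff_right u_f)
    then have "w $ i \<ge> 2 * \<alpha>" for i
      by (simp add: \<alpha>_def max_def field_simps)
    then have \<gamma>_nonneg: "\<gamma> i \<ge> 0" for i
      by (simp add: \<gamma>_def)
    have \<alpha>\<beta>_nonneg: "\<alpha> \<ge> 0" "\<beta> \<ge> 0"
      by (auto simp: \<alpha>_def \<beta>_def)
    have "(\<Sum>i\<in>UNIV. \<gamma> i) = (\<sigma> - 4 * real m * \<alpha>) / (2 * real m)"
      by (simp add: \<gamma>_def \<sigma>_def inner_one sum_subtractf card_index flip: sum_divide_distrib)
    then have sum1: "\<alpha> + \<beta> + (\<Sum>i\<in>UNIV. \<gamma> i) = 1"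
      using m_pos by (simp add: \<beta>_def field_simps)
    have "(\<Sum>i\<in>UNIV. \<gamma> i *\<^sub>R ((2 * real m) *\<^sub>R axis i 1 - 1)) = w - (2 * \<alpha>) *\<^sub>R 1 - (\<Sum>i\<in>UNIV. \<gamma> i) *\<^sub>R 1"
    proof -
      have "(\<Sum>i\<in>UNIV. \<gamma> i *\<^sub>R ((2 * real m) *\<^sub>R axis i 1)) = w - (2 * \<alpha>) *\<^sub>R 1"
        using m_pos by (simp add: vec_eq_iff axis_one_nth if_distrib \<gamma>_def cong: if_cong)
      then show ?thesis
        by (simp add: scaleR_diff_right sum_subtractf scaleR_left.sum)
    qed
    also have "\<dots> = u - (\<alpha> - \<beta>) *\<^sub>R 1"
    proof -
      have "(\<Sum>i\<in>UNIV. \<gamma> i) = 1 - \<alpha> - \<beta>" using sum1 by simp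
      then show ?thesis by (simp add: w_def vec_eq_iff)
    qed
    finally have u_eq: "\<alpha> *\<^sub>R 1 + (\<beta> *\<^sub>R (-1) + (\<Sum>i\<in>UNIV. \<gamma> i *\<^sub>R ((2 * real m) *\<^sub>R axis i 1 - 1))) = u"
      by (simp add: algebra_simps)
    \<comment> \<open>The index type \<open>'n option option\<close> holds the two apexes and the
      \<open>'n\<close> other generators in one family.\<close>
    define a where "a = case_option \<alpha> (case_option \<beta> \<gamma>)"
    define p where "p = case_option 1 (case_option (-1) (\<lambda>i. (2 * real m) *\<^sub>R axis i 1 - 1 :: real ^ 'n))"
    have "(\<Sum>x\<in>UNIV. a x *\<^sub>R p x) \<in> convex hull ?W"
    proof (rule convex_sum)
      show "sum a UNIV = 1"
        using sum1 by (simp add: a_def sum_UNIV_option)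
      show "0 \<le> a x" for x
        using \<gamma>_nonneg \<alpha>\<beta>_nonneg by (auto simp: a_def split: option.split)
      show "p x \<in> convex hull ?W" for x
        by (rule hull_inc) (auto simp: p_def split: option.split)
    qed auto
    moreover have "(\<Sum>x\<in>UNIV. a x *\<^sub>R p x) = u"
      by (simp add: a_def p_def sum_UNIV_option flip: u_eq)
    ultimately show "u \<in> convex hull ?W" by simp
  qed
qed

lemma reflexive_P: "reflexive N P"
proof -
  let ?W = "{1, -1} \<union> range (\<lambda>i. (2 * real m) *\<^sub>R axis i 1 - 1) :: (real ^ 'n) set"
  have "polytope P" by (simp add: P_eq_hull polytope_convex_hull finite_V)
  then have "lattice_polytope N P"
    using full_rank_lattice_N extreme_points_P V_subset_N by (simp add: lattice_polytope_def)
  moreover have "polytope (polar P)"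
    by (simp add: polar_P polytope_convex_hull)
  \<comment> \<open>On integral vectors the pairings are clearly integral; on \<open>f\<close> they
    are 2, -2 and 0.\<close>
  moreover have "?W \<subseteq> dual_lattice N"
  proof -
    have "(1 \<bullet> z) \<in> \<int>" if "\<forall>i. z $ i \<in> \<int>" for z :: "real ^ 'n"
      using that by (auto simp: inner_one intro!: Ints_sum)
    then show ?thesis
      using m_pos
      by (auto simp: dual_lattice_def N_eq inner_add_right inner_diff_left inner_axis'
          intro!: Ints_add Ints_mult Ints_diff)
  qed
  then have "{u. u extreme_point_of polar P} \<subseteq> dual_lattice N"
    unfolding polar_P using extreme_point_of_convex_hull by blast
  ultimately show ?thesis
    using zero_in_interior_P by (simp add: reflexive_def)
qed

text \<open>For positive \<open>k\<close>, rescale the inequalities. For \<open>k = 0\<close> the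
  dilate is the origin, and the inequalities leave only nonnegative coordinates with sum 0.\<close>

lemma scaled_P: "(\<lambda>x. real k *\<^sub>R x) ` P =
  {x. \<bar>1 \<bullet> x\<bar> \<le> real k \<and> (\<forall>i. 1 \<bullet> x - 2 * real m * x $ i \<le> real k)}" (is "_ = ?R")
proof (cases "k = 0")
  case True
  have "x = 0" if "x \<in> ?R" for x
  proof -
    have "(\<Sum>i\<in>UNIV. x $ i) = 0" "x $ i \<ge> 0" for i
      using that True m_pos by (auto simp: zero_le_mult_iff simp flip: inner_one)
    then have "\<forall>i. x $ i = 0"
      by (subst (asm) sum_nonneg_eq_0_iff) auto
    then show ?thesis by (simp add: vec_eq_iff)
  qed
  moreover have "0 \<in> P" by (simp add: P_eq)
  ultimately show ?thesis using True by auto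
next
  case False
  then have k: "real k > 0" by simp
  show ?thesis
  proof (intro equalityI subsetI)
    fix x assume "x \<in> (\<lambda>x. real k *\<^sub>R x) ` P"
    then obtain y where y: "y \<in> P" "x = real k *\<^sub>R y" by blast
    have "1 \<bullet> x - 2 * real m * x $ i \<le> real k" for i
    proof -
      have "real k * (1 \<bullet> y - 2 * real m * y $ i) \<le> real k * 1"
        using y k by (intro mult_left_mono) (auto simp: P_eq)
      then show ?thesis by (simp add: y algebra_simps)
    qed
    moreover have "\<bar>1 \<bullet> x\<bar> \<le> real k"
      using y k by (simp add: P_eq abs_mult mult_left_le)
    ultimately show "x \<in> ?R" by simp
  next
    fix x assume x: "x \<in> ?R"
    have "(1 / real k) *\<^sub>R x \<in> P"
    proof -
      have "1 \<bullet> x / real k - 2 * real m * (x $ i / real k) = (1 \<bullet> x - 2 * real m * x $ i) / real k" for i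
        by (simp add: diff_divide_distrib)
      moreover have "(1 \<bullet> x - 2 * real m * x $ i) / real k \<le> 1" for i
        using x k by simp
      ultimately show ?thesis using x k by (simp add: P_eq)
    qed
    then show "x \<in> (\<lambda>x. real k *\<^sub>R x) ` P"
      using k by (intro image_eqI[where x = "(1 / real k) *\<^sub>R x"]) auto
  qed
qed

subsection \<open>Lattice points of the dilates\<close>

text \<open>Normal form \<open>z + j f\<close> with minimum of \<open>z\<close> equal to 0. The wall
  expressions do not depend on \<open>j\<close>, and at a zero of \<open>z\<close> the expression is
  the full sum of \<open>z\<close>, so all walls together say that this sum is at most
  \<open>k\<close>.\<close>

lemma lattice_points_scaled_P:
  "bij_betw (\<lambda>(z, j). (\<chi> i. real (z i)) + of_int j *\<^sub>R f)
    (\<Union>a\<le>k. {z :: 'n \<Rightarrow> nat. sum z UNIV = a \<and> (\<exists>i. z i = 0)} \<times> {j. \<bar>int a + 2 * j\<bar> \<le> int k})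
    (N \<inter> (\<lambda>x. real k *\<^sub>R x) ` P)"
  (is "bij_betw ?F ?T _")
proof -
  let ?v = "\<lambda>z :: 'n \<Rightarrow> nat. \<chi> i. real (z i)"
  have F_sum: "1 \<bullet> (?v z + of_int j *\<^sub>R f) = of_int (int (sum z UNIV) + 2 * j)" for z j
    by (simp add: inner_add_right inner_one[of "?v z"])
  have F_nth: "(?v z + of_int j *\<^sub>R f) $ i = real (z i) + of_int j / real m" for z j i
    by simp
  have F_facet: "1 \<bullet> (?v z + of_int j *\<^sub>R f) - 2 * real m * (?v z + of_int j *\<^sub>R f) $ i =
    real (sum z UNIV) - 2 * real m * real (z i)" for z j i
    unfolding F_sum F_nth using m_pos by (simp add: field_simps)
  have "inj_on ?F ?T"
  proof (rule inj_onI, clarify)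
    fix z z' :: "'n \<Rightarrow> nat" and j j' i i'
    assume eq: "?v z + of_int j *\<^sub>R f = ?v z' + of_int j' *\<^sub>R f"
      and zero: "z i = 0" "z' i' = 0"
    have nth: "real (z l) + of_int j / real m = real (z' l) + of_int j' / real m" for l
      using eq F_nth by metis
    \<comment> \<open>The zeros of \<open>z\<close> and \<open>z'\<close> may sit at different
      indices; each gives one of the two inequalities.\<close>
    have "of_int j / real m = of_int j' / real m"
      using nth[of i] nth[of i'] zero by simp
    then show "z = z' \<and> j = j'"
      using nth m_pos by (auto simp: fun_eq_iff)
  qed
  moreover have "?F ` ?T = N \<inter> (\<lambda>x. real k *\<^sub>R x) ` P"
  proof (intro equalityI subsetI)
    fix x assume "x \<in> ?F ` ?T"
    then obtain z j where x: "x = ?v z + of_int j *\<^sub>R f"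
      and z: "sum z UNIV \<le> k" and j: "\<bar>int (sum z UNIV) + 2 * j\<bar> \<le> int k"
      by auto
    have "x \<in> N"
      unfolding x N_eq by (rule CollectI) (intro exI conjI, rule refl, simp)
    moreover have "\<bar>1 \<bullet> x\<bar> \<le> real k"
      unfolding x F_sum using j by linarith
    moreover have "1 \<bullet> x - 2 * real m * x $ i \<le> real k" for i
    proof -
      have "real (sum z UNIV) - 2 * real m * real (z i) \<le> real (sum z UNIV)" by simp
      also have "\<dots> \<le> real k" using z by (simp only: of_nat_le_iff)
      finally show ?thesis unfolding x F_facet .
    qed
    ultimately show "x \<in> N \<inter> (\<lambda>x. real k *\<^sub>R x) ` P"
      by (simp add: scaled_P)
  next
    fix x assume "x \<in> N \<inter> (\<lambda>x. real k *\<^sub>R x) ` P"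
    then have "x \<in> N" and sum_le: "\<bar>1 \<bullet> x\<bar> \<le> real k"
      and facet: "\<And>i. 1 \<bullet> x - 2 * real m * x $ i \<le> real k"
      by (auto simp: scaled_P)
    then obtain y j0 where x: "x = y + of_int j0 *\<^sub>R f" and y: "\<forall>i. y $ i \<in> \<int>"
      by (auto simp: N_eq)
    \<comment> \<open>Lowering every coordinate by \<mu> is compensated by \<open>m * \<mu>\<close>
      further copies of \<open>f\<close>.\<close>
    define \<mu> where "\<mu> = Min (range (\<lambda>i. \<lfloor>y $ i\<rfloor>))"
    define z where "z i = nat (\<lfloor>y $ i\<rfloor> - \<mu>)" for i
    define j where "j = j0 + int m * \<mu>"
    have "\<mu> \<in> range (\<lambda>i. \<lfloor>y $ i\<rfloor>)"
      unfolding \<mu>_def by (rule Min_in) auto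
    then obtain i0 where i0: "z i0 = 0" by (auto simp: z_def)
    have "\<mu> \<le> \<lfloor>y $ i\<rfloor>" for i
      unfolding \<mu>_def by (rule Min_le) auto
    then have "real (z i) = y $ i - of_int \<mu>" for i
      using y by (simp add: z_def)
    then have x_eq: "x = ?v z + of_int j *\<^sub>R f"
      using m_pos by (simp add: vec_eq_iff x j_def field_simps)
    have "sum z UNIV \<le> k"
    proof -
      have "real (sum z UNIV) \<le> real k"
        using facet[of i0] unfolding x_eq F_facet by (simp add: i0)
      then show ?thesis by (simp only: of_nat_le_iff)
    qed
    moreover have "\<bar>int (sum z UNIV) + 2 * j\<bar> \<le> int k"
      using sum_le unfolding x_eq F_sum by linarith
    ultimately have "(z, j) \<in> ?T" using i0 by auto
    then show "x \<in> ?F ` ?T" by (rule image_eqI[rotated]) (simp add: x_eq)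
  qed
  ultimately show ?thesis by (simp add: bij_betw_def)
qed

lemma lattice_count_P:
  "lattice_count N P k =
    (\<Sum>a\<le>k. card {z :: 'n \<Rightarrow> nat. sum z UNIV = a \<and> (\<exists>i. z i = 0)} * (k + (if even (a + k) then 1 else 0)))"
proof -
  have fin: "finite {z :: 'n \<Rightarrow> nat. sum z UNIV = a \<and> (\<exists>i. z i = 0)}" for a
    by (rule finite_subset[OF _ finite_nat_functions_sum[of a]]) auto
  have "lattice_count N P k = card (\<Union>a\<le>k. {z :: 'n \<Rightarrow> nat. sum z UNIV = a \<and> (\<exists>i. z i = 0)} \<times>
    {j. \<bar>int a + 2 * j\<bar> \<le> int k})"
    unfolding lattice_count_def using lattice_points_scaled_P[of k] by (simp only: bij_betw_same_card)
  also have "\<dots> = (\<Sum>a\<le>k. card ({z :: 'n \<Rightarrow> nat. sum z UNIV = a \<and> (\<exists>i. z i = 0)} \<times>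
    {j. \<bar>int a + 2 * j\<bar> \<le> int k}))"
    using fin by (intro card_UN_disjoint) (auto simp: abs_add_double_le_iff)
  finally show ?thesis
    by (simp only: card_cartesian_product card_abs_add_double_le)
qed

end

section \<open>The delta-vector of \<open>P\<close> and its descents\<close>

theorem mainTheorem3:
  fixes m :: nat
    and f :: "real ^ 'n"
    and N V P :: "(real ^ 'n) set"
    and \<delta> :: "real list"
  assumes "m > 0"
    and "CARD('n) = 2 * m"
    and "f = (\<chi> i. 1 / real m)"
    and "N = {z + of_int k *\<^sub>R f | z k. \<forall>i. z $ i \<in> \<int>}"
    and "V = {axis i 1 | i. True} \<union> {axis i 1 - f | i. True}"
    and "P = convex hull V"
    and "\<delta> = delta_vector N P"
  shows "{v. v extreme_point_of P} = V \<and>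
    reflexive N P \<and>
    length \<delta> = 2 * m + 1 \<and>
    \<delta> ! 0 = 1 \<and>
    \<delta> ! (2 * m) = 1 \<and>
    (\<forall>i. odd i \<and> 1 \<le> i \<and> i \<le> 2 * m - 1 \<longrightarrow> \<delta> ! i = 2 * real m) \<and>
    (\<forall>i. even i \<and> 2 \<le> i \<and> i \<le> 2 * m - 2 \<longrightarrow> \<delta> ! i = 2 * real m + 2) \<and>
    card (descents (take (m + 1) \<delta>)) = (m - 1) div 2"
proof -
  interpret simplex_prism m f N V P
    using assms(1-6) by (rule simplex_prism.intro)
  \<comment> \<open>The claimed entries, extended by 0 and written in the form of
    \<open>fps_parity_convolution\<close> with \<open>d = 2 * m\<close>.\<close>
  define q where "q i = (if i = 0 \<or> i = 2 * m then 1 else if i > 2 * m then 0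
    else if odd i then real (2 * m) else real (2 * m) + 2)" for i
  have dim: "DIM(real ^ 'n) = 2 * m"
    by (simp add: card_index)
  have "Abs_fps (\<lambda>a. real (card {z :: 'n \<Rightarrow> nat. sum z UNIV = a \<and> (\<exists>i. z i = 0)})) * (1 - fps_X) ^ (2 * m)
    = 1 - fps_X ^ (2 * m)"
    using fps_card_nat_functions_sum_zero[where 'n = 'n] by (simp only: card_index)
  then have "ehrhart_series N P * (1 - fps_X) ^ (2 * m + 1) = Abs_fps q"
    unfolding ehrhart_series_def lattice_count_P of_nat_sum of_nat_mult
    unfolding q_def using m_pos by (intro fps_parity_convolution) auto
  then have \<delta>_eq: "\<delta> = map q [0..<2 * m + 1]"
    using delta_vector_eqI[of N P q] by (simp only: assms(7) dim) (simp add: q_def)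
  have nth: "\<delta> ! i = q i" if "i \<le> 2 * m" for i
    using that unfolding \<delta>_eq by (simp del: upt_Suc)
  have length: "length \<delta> = 2 * m + 1"
    by (simp add: \<delta>_eq)
  \<comment> \<open>The truncated list stops at index \<open>m < 2 * m\<close>, before the final 1,
    and starts with a rise from 1 to \<open>2 * m\<close>. So descents occur exactly at the positive
    even indices below \<open>m\<close>.\<close>
  have "descents (take (m + 1) \<delta>) = (\<lambda>j. 2 * (j + 1)) ` {..<(m - 1) div 2}"
  proof (intro set_eqI iffI)
    fix i assume "i \<in> descents (take (m + 1) \<delta>)"
    then have i: "i < m" "q (i + 1) < q i"
      by (auto simp: descents_def length nth)
    then have "even i" "i \<noteq> 0"
      using m_pos by (auto simp: q_def split: if_splits)
    then obtain j where "i = 2 * (j + 1)"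
      by (metis dvd_def mult_0_right not0_implies_Suc Suc_eq_plus1)
    with i show "i \<in> (\<lambda>j. 2 * (j + 1)) ` {..<(m - 1) div 2}" by auto
  next
    fix i assume "i \<in> (\<lambda>j. 2 * (j + 1)) ` {..<(m - 1) div 2}"
    then obtain j where j: "i = 2 * (j + 1)" "j < (m - 1) div 2" by blast
    then have "i < m" by presburger
    with j show "i \<in> descents (take (m + 1) \<delta>)"
      by (auto simp: descents_def length nth q_def)
  qed
  then have "card (descents (take (m + 1) \<delta>)) = (m - 1) div 2"
    by (simp add: card_image inj_on_def)
  with extreme_points_P reflexive_P length m_pos show ?thesis
    by (auto simp: nth q_def)
qed

end
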